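(* Let $V$ and $V'$ be two-dimensional right vector spaces over skew fields $D$ and $D'$, respectively, let $H,H'$ be groups with $\mathrm{PEL}(V)\subseteq H\subseteq\mathrm{PGL}(V)$ and $\mathrm{PEL}(V')\subseteq H'\subseteq\mathrm{PGL}(V')$, and let $$\alpha:(H,\mathrm{Gr}_1(V))\longrightarrow(H',\mathrm{Gr}_1(V'))$$ be an isomorphism of permutation groups. Then there exists an isomorphism or anti-isomorphism of skew fields $\theta:D\to D'$ which induces $\alpha$.
   Context: A skew field is a (not necessarily commutative) division ring; an anti-isomorphism $\theta$ is an additive bijection with $1^\theta=1$ and $(xy)^\theta=y^\theta x^\theta$. $\mathrm{Gr}_1(V)$ is the set of one-dimensional subspaces of $V$. $\mathrm{GL}(V)$ is the group of $D$-linear bijections of $V$. A transvection of $V$ is a map $v\mapsto v+u\rho(v)$ with $u\in V$, $\rho\in\mathrm{Hom}_D(V,D)$ and $\rho(u)=0$; $\mathrm{EL}(V)$ is the subgroup of $\mathrm{GL}(V)$ generated by all transvections. $\mathrm{PGL}(V)$ and $\mathrm{PEL}(V)$ are the permutation groups induced by $\mathrm{GL}(V)$ and $\mathrm{EL}(V)$ on $\mathrm{Gr}_1(V)$. An isomorphism of permutation groups $(H,X)\to(H',X')$ consists of a group isomorphism $H\to H'$ and a bijection $X\to X'$ which is equivariant with respect to it. Relative to a base $b_0,b_1$ of $V$, the set $\mathrm{Gr}_1(V)$ is identified with $D\cup\{\infty\}$ by letting $x\in D$ correspond to $(b_0x+b_1)D$ and $\infty$ to $b_0D$; similarly for $V'$.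 That $\theta$ induces $\alpha$ means: for suitable bases of $V$ and $V'$, the bijection $\mathrm{Gr}_1(V)\to\mathrm{Gr}_1(V')$ belonging to $\alpha$ becomes the map $D\cup\{\infty\}\to D'\cup\{\infty\}$ with $x\mapsto x^\theta$ for $x\in D$ and $\infty\mapsto\infty$. *)

theory Defs
  imports "HOL-Algebra.Bij" "HOL-Algebra.Generated_Groups"
begin

section \<open>Right vector spaces over skew fields\<close>

text \<open>The vector spaces of the library have commutative scalars, so right vector spaces over a
  skew field (class \<^class>\<open>division_ring\<close>) are introduced here.\<close>

locale right_vector_space =
  fixes scale :: "'v::ab_group_add \<Rightarrow> 'd::division_ring \<Rightarrow> 'v"  (infixl "\<cdot>" 75)
  assumes scale_add_left: "(v + w) \<cdot> x = v \<cdot> x + w \<cdot> x"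
    and scale_add_right: "v \<cdot> (x + y) = v \<cdot> x + v \<cdot> y"
    and scale_mult: "v \<cdot> (x * y) = v \<cdot> x \<cdot> y"
    and scale_one: "v \<cdot> 1 = v"
begin

definition subspace :: "'v set \<Rightarrow> bool" where
  "subspace W \<longleftrightarrow> 0 \<in> W \<and> (\<forall>v\<in>W. \<forall>w\<in>W. v + w \<in> W) \<and> (\<forall>v\<in>W. \<forall>x. v \<cdot> x \<in> W)"

definition span :: "'v set \<Rightarrow> 'v set" where
  "span B = {\<Sum>b\<in>F. b \<cdot> c b | F c. finite F \<and> F \<subseteq> B}"

definition independent :: "'v set \<Rightarrow> bool" where
  "independent B \<longleftrightarrow>
     (\<forall>F c. finite F \<and> F \<subseteq> B \<and> (\<Sum>b\<in>F. b \<cdot> c b) = 0 \<longrightarrow> (\<forall>b\<in>F. c b = 0))"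

definition base_of :: "'v set \<Rightarrow> 'v set \<Rightarrow> bool" where
  "base_of W B \<longleftrightarrow> independent B \<and> span B = W"

definition has_dim :: "'v set \<Rightarrow> nat \<Rightarrow> bool" where
  "has_dim W n \<longleftrightarrow> (\<exists>B. base_of W B \<and> finite B \<and> card B = n)"

definition ordered_base2 :: "'v \<Rightarrow> 'v \<Rightarrow> bool" where
  "ordered_base2 b0 b1 \<longleftrightarrow> b0 \<noteq> b1 \<and> base_of UNIV {b0, b1}"

definition Gr1 :: "'v set set" where
  "Gr1 = {W. subspace W \<and> has_dim W 1}"

definition line :: "'v \<Rightarrow> 'v set" where
  "line v = range (\<lambda>x. v \<cdot> x)"


section \<open>Linear groups and the permutation groups they induce\<close>

definition linear_map :: "('v \<Rightarrow> 'v) \<Rightarrow> bool" where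
  "linear_map g \<longleftrightarrow> (\<forall>v w. g (v + w) = g v + g w) \<and> (\<forall>v x. g (v \<cdot> x) = g v \<cdot> x)"

definition linear_form :: "('v \<Rightarrow> 'd) \<Rightarrow> bool" where
  "linear_form \<rho> \<longleftrightarrow> (\<forall>v w. \<rho> (v + w) = \<rho> v + \<rho> w) \<and> (\<forall>v x. \<rho> (v \<cdot> x) = \<rho> v * x)"

definition GL :: "('v \<Rightarrow> 'v) monoid" where
  "GL = \<lparr>carrier = {g. linear_map g \<and> bij g}, mult = (\<circ>), one = id\<rparr>"

definition transvections :: "('v \<Rightarrow> 'v) set" where
  "transvections = {\<lambda>v. v + u \<cdot> \<rho> v | u \<rho>. linear_form \<rho> \<and> \<rho> u = 0}"

definition EL :: "('v \<Rightarrow> 'v) set" where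
  "EL = generate GL transvections"

definition induced_perm :: "('v \<Rightarrow> 'v) \<Rightarrow> 'v set \<Rightarrow> 'v set" where
  "induced_perm g = (\<lambda>W\<in>Gr1. g ` W)"

definition PGL :: "('v set \<Rightarrow> 'v set) set" where
  "PGL = induced_perm ` carrier GL"

definition PEL :: "('v set \<Rightarrow> 'v set) set" where
  "PEL = induced_perm ` EL"

end


section \<open>Isomorphisms\<close>

text \<open>A permutation group on \<open>X\<close> is a subgroup of the symmetric group \<^term>\<open>BijGroup X\<close>, whose
  elements are extensional functions.\<close>

definition perm_group_iso ::
    "('a \<Rightarrow> 'a) set \<Rightarrow> 'a set \<Rightarrow> ('b \<Rightarrow> 'b) set \<Rightarrow> 'b set
      \<Rightarrow> (('a \<Rightarrow> 'a) \<Rightarrow> ('b \<Rightarrow> 'b)) \<Rightarrow> ('a \<Rightarrow> 'b) \<Rightarrow> bool" where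
  "perm_group_iso H X H' X' \<phi> \<psi> \<longleftrightarrow>
     \<phi> \<in> iso (BijGroup X\<lparr>carrier := H\<rparr>) (BijGroup X'\<lparr>carrier := H'\<rparr>) \<and>
     bij_betw \<psi> X X' \<and>
     (\<forall>h\<in>H. \<forall>x\<in>X. \<psi> (h x) = \<phi> h (\<psi> x))"

definition skew_field_iso :: "('d::division_ring \<Rightarrow> 'e::division_ring) \<Rightarrow> bool" where
  "skew_field_iso \<theta> \<longleftrightarrow> bij \<theta> \<and> \<theta> 1 = 1 \<and>
     (\<forall>x y. \<theta> (x + y) = \<theta> x + \<theta> y) \<and> (\<forall>x y. \<theta> (x * y) = \<theta> x * \<theta> y)"

definition skew_field_anti_iso :: "('d::division_ring \<Rightarrow> 'e::division_ring) \<Rightarrow> bool" where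
  "skew_field_anti_iso \<theta> \<longleftrightarrow> bij \<theta> \<and> \<theta> 1 = 1 \<and>
     (\<forall>x y. \<theta> (x + y) = \<theta> x + \<theta> y) \<and> (\<forall>x y. \<theta> (x * y) = \<theta> y * \<theta> x)"

text \<open>Only the bijection \<open>\<psi>\<close> between the sets of one-dimensional subspaces matters here: a
  permutation group acts faithfully, so \<open>\<psi>\<close> determines the isomorphism of the groups.\<close>

definition induces ::
    "('v::ab_group_add \<Rightarrow> 'd::division_ring \<Rightarrow> 'v) \<Rightarrow> ('w::ab_group_add \<Rightarrow> 'e::division_ring \<Rightarrow> 'w)
      \<Rightarrow> ('d \<Rightarrow> 'e) \<Rightarrow> ('v set \<Rightarrow> 'w set) \<Rightarrow> bool" where
  "induces s s' \<theta> \<psi> \<longleftrightarrow>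
     (\<exists>b0 b1 c0 c1.
        right_vector_space.ordered_base2 s b0 b1 \<and>
        right_vector_space.ordered_base2 s' c0 c1 \<and>
        (\<forall>x. \<psi> (right_vector_space.line s (s b0 x + b1)) =
              right_vector_space.line s' (s' c0 (\<theta> x) + c1)) \<and>
        \<psi> (right_vector_space.line s b0) = right_vector_space.line s' c0)"

end

theory Submission imports Defs begin

text \<open>The stabiliser of \<open>\<infinity>\<close> acts on \<open>D\<close> by maps \<open>x \<mapsto> a x b + d\<close>, and the translations in it
  form an abelian normal subgroup. They are its largest abelian normal subgroup: if \<open>f x = a x b + d\<close>
  lies in another one, \<open>N\<close>, and is not a translation, then commutators of \<open>f\<close> with translations give
  a nonzero translation \<open>e\<close> in \<open>N\<close>. As \<open>N\<close> is invariant under \<open>x \<mapsto> y x y\<close>, it contains the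
  translations by \<open>k e\<close> for all multiplicative commutators \<open>k\<close>; these commute with \<open>f\<close>, so \<open>a\<close>
  commutes with every \<open>k\<close>, hence is central, and \<open>b = a\<^sup>-\<^sup>1\<close>, a contradiction.

  So the coordinate map \<open>\<theta>\<close> conjugates translations into translations, that is, \<open>\<theta>\<close> is additive.
  The same argument at the point \<open>0\<close> shows that \<open>x \<mapsto> \<theta>(x\<^sup>-\<^sup>1)\<^sup>-\<^sup>1\<close> is additive. Together these give
  \<open>\<theta>((1 - x)\<^sup>-\<^sup>1) = (1 - \<theta> x)\<^sup>-\<^sup>1\<close>, because \<open>(x\<^sup>-\<^sup>1 - 1)\<^sup>-\<^sup>1 + 1 = (1 - x)\<^sup>-\<^sup>1\<close>, and Hua's theorem on additive
  maps preserving inverses applies.\<close>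

section \<open>Skew fields\<close>

lemma commutes_inverse:
  fixes a x :: "'d::division_ring"
  assumes "a * x = x * a"
  shows "a * inverse x = inverse x * a"
proof (cases "x = 0")
  case False
  have "a * inverse x = inverse x * (x * a) * inverse x" using False by (simp add: mult.assoc [symmetric])
  also have "\<dots> = inverse x * a" using False by (simp add: assms [symmetric] mult.assoc)
  finally show ?thesis .
qed simp

text \<open>The commutators \<open>k\<close> of \<open>a\<close> with \<open>x\<close> and
  \<open>l\<close> of \<open>a\<close> with \<open>x + 1\<close> satisfy
  \<open>(k - l) * x = l - 1\<close>. Either \<open>k = l\<close>, which forces
  \<open>k = 1\<close>, or \<open>x\<close> is a rational expression in \<open>k\<close> and
  \<open>l\<close>, both of which commute with \<open>a\<close>.\<close>

lemma central_if_commutes_with_commutators: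
  fixes a :: "'d::division_ring"
  assumes comm: "\<And>x y. x \<noteq> 0 \<Longrightarrow> y \<noteq> 0 \<Longrightarrow>
    a * (x * y * inverse x * inverse y) = x * y * inverse x * inverse y * a"
  shows "a * x = x * a"
proof (cases "a = 0 \<or> x = 0 \<or> x + 1 = 0")
  case True
  then show ?thesis using eq_neg_iff_add_eq_0[of x 1] by auto
next
  case False
  define k where "k = a * x * inverse a * inverse x"
  define l where "l = a * (x + 1) * inverse a * inverse (x + 1)"
  have ka: "a * k = k * a" and la: "a * l = l * a"
    using comm[of a x] comm[of a "x + 1"] False by (auto simp: k_def l_def)
  have kx: "k * x * a = a * x"
    using False by (simp add: k_def mult.assoc)
  have lx: "l * (x + 1) * a = a * (x + 1)"
    using False by (simp add: l_def mult.assoc)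
  have "(k * x + 1) * a = l * (x + 1) * a"
    using kx lx by (simp add: distrib_left distrib_right)
  then have "k * x + 1 = l * (x + 1)"
    using False by simp
  then have eq: "(k - l) * x = l - 1"
    by (simp add: algebra_simps)
  show ?thesis
  proof (cases "k = l")
    case True
    with eq have "k = 1" by simp
    with kx show ?thesis by simp
  next
    case kl: False
    have "x = inverse (k - l) * ((k - l) * x)"
      using kl by (simp add: mult.assoc [symmetric])
    then have x: "x = inverse (k - l) * (l - 1)" by (simp only: eq)
    have i: "a * inverse (k - l) = inverse (k - l) * a"
      by (rule commutes_inverse) (simp add: algebra_simps ka la)
    have "a * x = inverse (k - l) * a * (l - 1)"
      by (subst x) (simp add: i mult.assoc [symmetric])
    also have "\<dots> = x * a"
    proof -
      have "a * (l - 1) = (l - 1) * a" by (simp add: algebra_simps la)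
      then have "inverse (k - l) * a * (l - 1) = inverse (k - l) * (l - 1) * a"
        by (simp add: mult.assoc)
      then show ?thesis using x by simp
    qed
    finally show ?thesis .
  qed
qed

section \<open>Maps that transport translations into affine maps\<close>

text \<open>The shape of the permutations that the stabiliser of the point at infinity induces on
  the scalars. Both factors are kept because multiplication need not commute.\<close>

definition affine :: "('d::division_ring \<Rightarrow> 'd) \<Rightarrow> bool" where
  "affine f \<longleftrightarrow> (\<exists>a b d. a \<noteq> 0 \<and> b \<noteq> 0 \<and> (\<forall>x. f x = a * x * b + d))"

text \<open>The translations of the source, transported by \<open>\<theta>\<close>, form an abelian
  group of affine maps of the target. By \<open>trans'\<close> and \<open>hua'\<close> this group is
  normalised by the translations of the target and by its maps \<open>z \<mapsto> y * z * y\<close>,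
  which leaves room for translations only.\<close>

lemma additive_if_conjugates_affine:
  fixes \<theta> :: "'d::division_ring \<Rightarrow> 'e::division_ring"
  assumes inv1 [simp]: "\<And>x. \<eta> (\<theta> x) = x" and inv2 [simp]: "\<And>y. \<theta> (\<eta> y) = y"
    and zero: "\<theta> 0 = 0"
    and trans: "\<And>c. affine (\<lambda>y. \<theta> (\<eta> y + c))"
    and trans': "\<And>c. affine (\<lambda>x. \<eta> (\<theta> x + c))"
    and hua': "\<And>y. y \<noteq> 0 \<Longrightarrow> affine (\<lambda>x. \<eta> (y * \<theta> x * y))"
  shows "\<theta> (x + c) = \<theta> x + \<theta> c"
proof -
  \<comment> \<open>The transported translations; the goal is that each \<open>f c\<close> is a
    translation of the target.\<close>
  define f where "f c y = \<theta> (\<eta> y + c)" for c y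
  have f_add: "f c (f c' y) = f (c' + c) y" for c c' y
    by (simp add: f_def add.assoc)
  have f0: "f 0 y = y" for y by (simp add: f_def)
  \<comment> \<open>A map \<open>h\<close> that is affine in the coordinate of the source normalises
    the translations there: the amount \<open>c\<close> becomes \<open>a * c * b\<close>.\<close>
  have f_conj: "\<exists>c'. \<forall>y. h (f c y) = f c' (h y)" if "affine (\<lambda>x. \<eta> (h (\<theta> x)))" for h c
  proof -
    from that obtain a b d where h: "\<And>x. \<eta> (h (\<theta> x)) = a * x * b + d"
      by (auto simp: affine_def)
    have h': "h y = \<theta> (a * \<eta> y * b + d)" for y
      using h[of "\<eta> y"] by (metis inv2)
    have "h (f c y) = f (a * c * b) (h y)" for y
      by (simp add: h' f_def algebra_simps)
    then show ?thesis by blast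
  qed
  \<comment> \<open>The amounts of those translations of the target that occur among the maps
    \<open>f c\<close>.\<close>
  define E where "E = {e. \<exists>c. \<forall>y. f c y = y + e}"
  have E_hua: "y * e * y \<in> E" if "y \<noteq> 0" "e \<in> E" for y e
  proof -
    from \<open>e \<in> E\<close> obtain c where c: "\<And>z. f c z = z + e" by (auto simp: E_def)
    obtain c' where "\<And>z. y * f c z * y = f c' (y * z * y)"
      using f_conj[of "\<lambda>z. y * z * y" c] hua' \<open>y \<noteq> 0\<close> by auto
    then have c': "f c' (y * z * y) = y * z * y + y * e * y" for z
      by (metis c distrib_left distrib_right)
    \<comment> \<open>Every element has the form \<open>y * z * y\<close>, so \<open>c'\<close>
      determines \<open>f c'\<close> everywhere.\<close>
    have "f c' z = z + y * e * y" for z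
      using c'[of "inverse y * z * inverse y"] \<open>y \<noteq> 0\<close>
      by (simp add: mult.assoc) (simp add: mult.assoc [symmetric])
    then show ?thesis by (auto simp: E_def)
  qed
  have E_comm: "x * y * inverse x * inverse y * e \<in> E" if "x \<noteq> 0" "y \<noteq> 0" "e \<in> E" for x y e
  proof -
    \<comment> \<open>Three applications of \<open>E_hua\<close>. The innermost one uses
      \<open>inverse (y * x)\<close>, whose right-hand copy is cancelled by the outer factors
      \<open>y\<close> and \<open>x\<close>.\<close>
    have "x * (y * (inverse (y * x) * e * inverse (y * x)) * y) * x \<in> E"
      using that by (intro E_hua) auto
    moreover have "x * (y * (inverse (y * x) * e * inverse (y * x)) * y) * x
        = x * y * inverse x * inverse y * e"
      using that by (simp add: nonzero_inverse_mult_distrib mult.assoc)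
    ultimately show ?thesis by simp
  qed
  obtain a b d where ab: "a \<noteq> 0" "b \<noteq> 0" and f: "\<And>y. f c y = a * y * b + d"
    using trans[of c] by (auto simp: affine_def f_def)
  \<comment> \<open>\<open>f c\<close> commutes with the translation by \<open>e\<close>, which is
    itself one of the transported maps; comparing values at 0 gives the claim.\<close>
  have fix_E: "a * e * b = e" if "e \<in> E" for e
  proof -
    from that obtain c' where c': "\<And>y. f c' y = y + e" by (auto simp: E_def)
    have "f c (f c' 0) = f c' (f c 0)" by (simp add: f_add add.commute)
    then show ?thesis by (simp add: c' f)
  qed
  \<comment> \<open>The commutator of \<open>f c\<close> with the translation by \<open>e\<close> is
    the translation by \<open>e - a * e * b\<close>. It is again some \<open>f c''\<close> because
    translations normalise the transported group.\<close>
  have diff_E: "e - a * e * b \<in> E" for e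
  proof -
    obtain c' where c': "\<And>z. f c z + e = f c' (z + e)"
      using f_conj[of "\<lambda>z. z + e" c] trans' by auto
    have "f (c' - c) y = y + (e - a * e * b)" for y
    proof -
      have 1: "f c' z = f c (z - e) + e" for z using c'[of "z - e"] by simp
      have "f (c' - c) y = f c' (f (- c) y)" by (simp add: f_add)
      also have "\<dots> = f c (f (- c) y) + (e - a * e * b)"
        by (simp add: 1 f algebra_simps)
      also have "f c (f (- c) y) = y" by (simp add: f_add f0)
      finally show ?thesis .
    qed
    then show ?thesis by (auto simp: E_def)
  qed
  have lin: "a * e * b = e" for e
  proof (rule ccontr)
    assume neq: "a * e * b \<noteq> e"
    define e0 where "e0 = e - a * e * b"
    have e0: "e0 \<noteq> 0" "e0 \<in> E" using neq diff_E by (auto simp: e0_def)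
    have a1: "a * e0 * b = e0" using e0 fix_E by simp
    \<comment> \<open>Both \<open>e0\<close> and \<open>k * e0\<close> lie in \<open>E\<close> and
      are therefore fixed by \<open>z \<mapsto> a * z * b\<close>; cancelling \<open>e0 * b\<close>
      leaves the commutation of \<open>a\<close> with \<open>k\<close>.\<close>
    have comm: "a * k = k * a" if k: "k = x * y * inverse x * inverse y" "x \<noteq> 0" "y \<noteq> 0" for k x y
    proof -
      have "a * (k * e0) * b = k * e0"
        using fix_E[OF E_comm[OF k(2,3) e0(2)]] k(1) by simp
      also have "\<dots> = k * (a * e0 * b)" by (simp add: a1)
      finally have "(a * k) * (e0 * b) = (k * a) * (e0 * b)" by (simp add: mult.assoc)
      then show ?thesis using e0 ab by simp
    qed
    have central: "a * z = z * a" for z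
      by (rule central_if_commutes_with_commutators) (rule comm [OF refl])
    have "e0 * (a * b) = e0 * 1" using a1 by (simp only: central[of e0] mult.assoc mult_1_right)
    then have "a * b = 1" using mult_left_cancel[OF e0(1)] by blast
    then have "a * e * b = e" by (simp only: central[of e] mult.assoc mult_1_right)
    with neq show False ..
  qed
  have "\<eta> 0 = 0" using zero inv1[of 0] by simp
  then have "d = \<theta> c" using f[of 0] by (simp add: f_def)
  then show ?thesis using f[of "\<theta> x"] by (simp add: lin f_def)
qed

section \<open>Hua's theorem on additive maps that preserve inverses\<close>

text \<open>Hua's identity writes \<open>a * b * a\<close> through differences, sums and inverses,
  so \<open>\<theta>\<close> respects this triple product and is a Jordan homomorphism. Each single
  product is then preserved or reversed, and additivity makes the choice uniform.\<close>

lemma hua_theorem: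
  fixes \<theta> :: "'d::division_ring \<Rightarrow> 'e::division_ring"
  assumes bij: "bij \<theta>" and one: "\<theta> 1 = 1"
    and add: "\<And>x y. \<theta> (x + y) = \<theta> x + \<theta> y"
    and inverse: "\<And>x. \<theta> (inverse x) = inverse (\<theta> x)"
  shows "skew_field_iso \<theta> \<or> skew_field_anti_iso \<theta>"
proof -
  have zero: "\<theta> 0 = 0" using add[of 0 0] by simp
  have minus: "\<theta> (- x) = - \<theta> x" for x
    using add[of x "- x"] zero by (simp add: eq_neg_iff_add_eq_0 add.commute)
  have diff: "\<theta> (x - y) = \<theta> x - \<theta> y" for x y
    using add[of x "- y"] minus by simp
  have eq0: "\<theta> x = 0 \<longleftrightarrow> x = 0" for x
    using bij zero by (metis bij_is_inj injD)
  \<comment> \<open>Hua's identity: the sum under the outer inverse factors as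
    \<open>inverse a * inverse b * inverse (inverse b - a)\<close>.\<close>
  have hua: "a * b * a = a - inverse (inverse a + inverse (inverse b - a))"
    if "a \<noteq> 0" "b \<noteq> 0" "inverse b \<noteq> a" for a b :: "'x::division_ring"
  proof -
    have u: "inverse b - a \<noteq> 0" using that by simp
    have "inverse a + inverse (inverse b - a) = inverse a * (inverse b * inverse (inverse b - a))"
      using division_ring_inverse_add[OF that(1) u] by (simp add: mult.assoc)
    then have "inverse (inverse a + inverse (inverse b - a)) = (inverse b - a) * b * a"
      using that u by (simp add: nonzero_inverse_mult_distrib)
    then show ?thesis using that by (simp add: algebra_simps)
  qed
  have triple: "\<theta> (a * b * a) = \<theta> a * \<theta> b * \<theta> a" for a b
  proof (cases "a = 0 \<or> b = 0 \<or> inverse b = a")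
    case True
    then show ?thesis by (cases "b = 0") (auto simp: zero inverse eq0)
  next
    case False
    then have "inverse (\<theta> b) \<noteq> \<theta> a"
      using bij inverse by (metis bij_is_inj injD)
    with False have "\<theta> a * \<theta> b * \<theta> a
        = \<theta> a - inverse (inverse (\<theta> a) + inverse (inverse (\<theta> b) - \<theta> a))"
      by (intro hua) (auto simp: eq0)
    also have "\<dots> = \<theta> (a - inverse (inverse a + inverse (inverse b - a)))"
      by (simp add: add diff inverse)
    finally show ?thesis using hua[of a b] False by simp
  qed
  have square: "\<theta> (a * a) = \<theta> a * \<theta> a" for a using triple[of a 1] one by simp
  have jordan: "\<theta> (a * b) + \<theta> (b * a) = \<theta> a * \<theta> b + \<theta> b * \<theta> a" for a b
    using square[of "a + b"] by (simp add: algebra_simps add square)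
  have dichotomy: "\<theta> (a * b) = \<theta> a * \<theta> b \<or> \<theta> (a * b) = \<theta> b * \<theta> a" for a b
  proof (cases "a = 0 \<or> b = 0")
    case False
    define t where "t = \<theta> (a * b)"
    have t: "t \<noteq> 0" using False by (simp add: t_def eq0)
    have "\<theta> a * (\<theta> b * inverse t * \<theta> b) * \<theta> a = \<theta> (a * (b * inverse (a * b) * b) * a)"
      by (simp add: triple inverse t_def)
    also have "a * (b * inverse (a * b) * b) * a = b * a"
      using False by (simp add: nonzero_inverse_mult_distrib mult.assoc [symmetric])
    finally have ba: "\<theta> a * (\<theta> b * inverse t * \<theta> b) * \<theta> a = \<theta> (b * a)" .
    \<comment> \<open>By \<open>ba\<close>, this product expands to
      \<open>\<theta> (a * b) + \<theta> (b * a)\<close> minus the two products of the images, which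
      is 0 by \<open>jordan\<close>. Hence one of the outer factors vanishes.\<close>
    have "(t - \<theta> a * \<theta> b) * inverse t * (t - \<theta> b * \<theta> a)
        = t - \<theta> b * \<theta> a - \<theta> a * \<theta> b + \<theta> a * (\<theta> b * inverse t * \<theta> b) * \<theta> a"
      using t by (simp add: left_diff_distrib right_diff_distrib mult.assoc)
    also have "\<dots> = 0" unfolding ba using jordan[of a b] by (simp add: t_def algebra_simps)
    finally show ?thesis using t by (auto simp: t_def)
  qed (auto simp: zero)
  let ?M = "\<lambda>a b. \<theta> (a * b) = \<theta> a * \<theta> b" and ?A = "\<lambda>a b. \<theta> (a * b) = \<theta> b * \<theta> a"
  text \<open>A group is not the union of two proper subgroups.\<close>
  have left: "(\<forall>b. ?M a b) \<or> (\<forall>b. ?A a b)" for a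
  proof (rule ccontr)
    assume "\<not> ?thesis"
    then obtain b c where b: "\<not> ?M a b" and c: "\<not> ?A a c" by blast
    then have bc: "?A a b" "?M a c" using dichotomy by blast+
    from dichotomy[of a "b + c"] show False
      using b c bc by (auto simp: add distrib_left distrib_right)
  qed
  \<comment> \<open>The union argument once more, now in the first factor: if \<open>a\<close> only
    reverses and \<open>c\<close> only preserves products, then \<open>a + c\<close> can do
    neither.\<close>
  have "(\<forall>a b. ?M a b) \<or> (\<forall>a b. ?A a b)"
  proof (rule ccontr)
    assume "\<not> ?thesis"
    then obtain a b c d where M: "\<not> ?M a b" and A: "\<not> ?A c d" by blast
    then have Aa: "\<forall>x. ?A a x" and Mc: "\<forall>x. ?M c x" using left by blast+
    have eqs: "\<theta> (a * x) = \<theta> x * \<theta> a" "\<theta> (c * x) = \<theta> c * \<theta> x" for x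
      using Aa Mc by auto
    from left[of "a + c"] show False
    proof
      assume "\<forall>x. ?M (a + c) x"
      then have "?M (a + c) b" by blast
      then show False using M by (simp add: add distrib_left distrib_right eqs)
    next
      assume "\<forall>x. ?A (a + c) x"
      then have "?A (a + c) d" by blast
      then show False using A by (simp add: add distrib_left distrib_right eqs)
    qed
  qed
  then show ?thesis
    using bij one add by (auto simp: skew_field_iso_def skew_field_anti_iso_def)
qed


section \<open>The projective line\<close>

context right_vector_space
begin

section \<open>Scalars and coordinates with respect to a base\<close>

lemma scale_zero_right [simp]: "v \<cdot> 0 = 0"
  using scale_add_right[of v 0 0] by simp

lemma scale_zero_left [simp]: "0 \<cdot> x = 0"
  using scale_add_left[of 0 0 x] by simp

lemma scale_minus_right: "v \<cdot> (- x) = - (v \<cdot> x)"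
  using scale_add_right[of v x "- x"] by (simp add: eq_neg_iff_add_eq_0 add.commute)

lemma scale_inverse_cancel: "x \<noteq> 0 \<Longrightarrow> v \<cdot> x \<cdot> inverse x = v"
  by (simp add: scale_mult [symmetric] scale_one)

lemma scale_eq_0_iff: "v \<cdot> x = 0 \<longleftrightarrow> v = 0 \<or> x = 0"
  using scale_inverse_cancel[of x v] by auto

text \<open>Sums over subsets of the base are replaced by combinations with exactly two
  coefficients; all later work with bases uses this form.\<close>

lemma ordered_base2_iff:
  "ordered_base2 u w \<longleftrightarrow>
    (\<forall>v. \<exists>x y. v = u \<cdot> x + w \<cdot> y) \<and> (\<forall>x y. u \<cdot> x + w \<cdot> y = 0 \<longrightarrow> x = 0 \<and> y = 0)"
  (is "?L \<longleftrightarrow> ?S \<and> ?I")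
proof -
  \<comment> \<open>Base vectors outside \<open>F\<close> receive the coefficient 0.\<close>
  have expand: "(\<Sum>b\<in>F. b \<cdot> c b) = u \<cdot> (if u \<in> F then c u else 0) + w \<cdot> (if w \<in> F then c w else 0)"
    if "u \<noteq> w" "F \<subseteq> {u, w}" for F c
  proof -
    have "(\<Sum>b\<in>F. b \<cdot> c b) = (\<Sum>b\<in>{u, w}. b \<cdot> (if b \<in> F then c b else 0))"
      using that by (intro sum.mono_neutral_cong_left) auto
    then show ?thesis using that by simp
  qed
  show ?thesis
  proof
    assume L: ?L
    then have uw: "u \<noteq> w" and ind: "independent {u, w}" and span: "span {u, w} = UNIV"
      by (auto simp: ordered_base2_def base_of_def)
    have ?S
    proof
      fix v
      have "v \<in> span {u, w}" using span by simp
      then obtain F c where "F \<subseteq> {u, w}" "v = (\<Sum>b\<in>F. b \<cdot> c b)"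
        by (auto simp: span_def)
      then show "\<exists>x y. v = u \<cdot> x + w \<cdot> y" using expand[OF uw] by blast
    qed
    moreover have ?I
    proof (intro allI impI)
      fix x y assume "u \<cdot> x + w \<cdot> y = 0"
      then have "(\<Sum>b\<in>{u, w}. b \<cdot> (if b = u then x else y)) = 0"
        using uw by simp
      then have "\<forall>b\<in>{u, w}. (if b = u then x else y) = 0"
        using ind unfolding independent_def
        by (elim allE[of _ "{u, w}"] allE[of _ "\<lambda>b. if b = u then x else y"]) simp
      then show "x = 0 \<and> y = 0" using uw by simp
    qed
    ultimately show "?S \<and> ?I" ..
  next
    assume SI: "?S \<and> ?I"
    have uw: "u \<noteq> w"
    proof
      assume "u = w"
      then have "u \<cdot> 1 + w \<cdot> (- 1) = 0" by (simp add: scale_minus_right)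
      then have "(1::'d) = 0" using SI by blast
      then show False by simp
    qed
    have "independent {u, w}"
      unfolding independent_def
    proof (intro allI impI, elim conjE)
      fix F c assume F: "F \<subseteq> {u, w}" and "(\<Sum>b\<in>F. b \<cdot> c b) = 0"
      then have "u \<cdot> (if u \<in> F then c u else 0) + w \<cdot> (if w \<in> F then c w else 0) = 0"
        by (simp only: expand[OF uw F])
      then have "(if u \<in> F then c u else 0) = 0 \<and> (if w \<in> F then c w else 0) = 0"
        using SI by blast
      then show "\<forall>b\<in>F. c b = 0" using F by (auto split: if_splits)
    qed
    moreover have "v \<in> span {u, w}" for v
    proof -
      obtain x y where "v = u \<cdot> x + w \<cdot> y" using SI by blast
      then have "v = (\<Sum>b\<in>{u, w}. b \<cdot> (if b = u then x else y))" using uw by simp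
      then show ?thesis
        unfolding span_def
        by (intro CollectI exI[of _ "{u, w}"] exI[of _ "\<lambda>b. if b = u then x else y"]) simp
    qed
    ultimately show ?L using uw by (auto simp: ordered_base2_def base_of_def)
  qed
qed

lemma ordered_base2_coords: "ordered_base2 u w \<Longrightarrow> \<exists>x y. v = u \<cdot> x + w \<cdot> y"
  unfolding ordered_base2_iff by blast

lemma ordered_base2_independent:
  "ordered_base2 u w \<Longrightarrow> u \<cdot> x + w \<cdot> y = 0 \<Longrightarrow> x = 0 \<and> y = 0"
  unfolding ordered_base2_iff by blast

section \<open>Lines as points of the projective line\<close>

lemma mem_line: "w \<in> line v \<longleftrightarrow> (\<exists>x. w = v \<cdot> x)"
  by (auto simp: line_def)

lemma line_scale: "x \<noteq> 0 \<Longrightarrow> line (v \<cdot> x) = line v"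
proof -
  assume x: "x \<noteq> 0"
  have "v \<cdot> x \<cdot> z = v \<cdot> (x * z)" "v \<cdot> z = v \<cdot> x \<cdot> (inverse x * z)" for z
    using x by (simp_all add: scale_mult scale_inverse_cancel)
  then show ?thesis unfolding set_eq_iff mem_line by metis
qed

lemma line_eqI: "w \<in> line v \<Longrightarrow> w \<noteq> 0 \<Longrightarrow> line w = line v"
  by (auto simp: mem_line scale_eq_0_iff line_scale)

lemma self_in_line: "v \<in> line v"
  unfolding mem_line by (metis scale_one)

text \<open>A base of a one-dimensional subspace is a singleton whose vector is nonzero, and its
  span is the line of that vector.\<close>

lemma Gr1_iff: "W \<in> Gr1 \<longleftrightarrow> (\<exists>v. v \<noteq> 0 \<and> W = line v)"
proof
  assume "W \<in> Gr1"
  then obtain b where ind: "independent {b}" and span: "span {b} = W"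
    by (auto simp: Gr1_def has_dim_def base_of_def card_1_singleton_iff)
  have "b \<noteq> 0"
  proof
    assume "b = 0"
    with ind[unfolded independent_def, rule_format, of "{b}" "\<lambda>_. 1" b] show False by simp
  qed
  moreover have "span {b} = line b"
  proof (intro equalityI subsetI)
    fix v assume "v \<in> span {b}"
    then obtain F c where "F \<subseteq> {b}" "v = (\<Sum>b\<in>F. b \<cdot> c b)" by (auto simp: span_def)
    then have "v = b \<cdot> (if b \<in> F then c b else 0)" by (auto simp: subset_singleton_iff)
    then show "v \<in> line b" unfolding mem_line ..
  next
    fix v assume "v \<in> line b"
    then obtain x where "v = b \<cdot> x" by (auto simp: mem_line)
    then show "v \<in> span {b}"
      unfolding span_def by (intro CollectI exI[of _ "{b}"] exI[of _ "\<lambda>_. x"]) simp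
  qed
  ultimately show "\<exists>v. v \<noteq> 0 \<and> W = line v" using span by blast
next
  assume "\<exists>v. v \<noteq> 0 \<and> W = line v"
  then obtain v where v: "v \<noteq> 0" "W = line v" by blast
  have "subspace W"
    unfolding subspace_def v(2) line_def using rangeI[of "(\<cdot>) v" 0]
    by (auto simp: scale_add_right [symmetric] scale_mult [symmetric])
  moreover have "independent {v}"
    unfolding independent_def
    using v(1) by (auto simp: subset_singleton_iff scale_eq_0_iff)
  moreover have "span {v} = W"
  proof (intro equalityI subsetI)
    fix w assume "w \<in> span {v}"
    then obtain F c where "F \<subseteq> {v}" "w = (\<Sum>b\<in>F. b \<cdot> c b)" by (auto simp: span_def)
    then have "w = v \<cdot> (if v \<in> F then c v else 0)" by (auto simp: subset_singleton_iff)
    then show "w \<in> W" unfolding v(2) mem_line ..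
  next
    fix w assume "w \<in> W"
    then obtain x where "w = v \<cdot> x" by (auto simp: mem_line v)
    then show "w \<in> span {v}"
      unfolding span_def by (intro CollectI exI[of _ "{v}"] exI[of _ "\<lambda>_. x"]) simp
  qed
  ultimately show "W \<in> Gr1"
    by (auto simp: Gr1_def has_dim_def base_of_def intro!: exI[of _ "{v}"])
qed

section \<open>Linear maps and the permutations they induce\<close>

lemma linear_image_line: "linear_map g \<Longrightarrow> g ` line v = line (g v)"
  unfolding line_def image_image by (simp add: linear_map_def)

lemma linear_map_nonzero:
  assumes "linear_map g" "bij g" "v \<noteq> 0"
  shows "g v \<noteq> 0"
proof
  assume "g v = 0"
  moreover have "g 0 = 0" using assms(1) scale_zero_right by (metis linear_map_def)
  ultimately show False using assms by (metis bij_is_inj injD)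
qed

lemma induced_perm_line: "linear_map g \<Longrightarrow> v \<noteq> 0 \<Longrightarrow> induced_perm g (line v) = line (g v)"
  using linear_image_line[of g v] by (auto simp: induced_perm_def Gr1_iff)

lemma PGL_closed:
  assumes "h \<in> PGL" "W \<in> Gr1"
  shows "h W \<in> Gr1"
proof -
  from assms obtain g v where g: "linear_map g" "bij g" "h = induced_perm g"
    and v: "v \<noteq> 0" "W = line v"
    by (auto simp: PGL_def GL_def Gr1_iff)
  then show ?thesis
    using linear_map_nonzero[of g v] by (auto simp: induced_perm_line Gr1_iff)
qed

lemma EL_comp: "g \<in> EL \<Longrightarrow> h \<in> EL \<Longrightarrow> g \<circ> h \<in> EL"
  unfolding EL_def using generate.eng[of g GL transvections h] by (simp add: GL_def)

lemma transvection_in_EL: "linear_form \<rho> \<Longrightarrow> \<rho> u = 0 \<Longrightarrow> (\<lambda>v. v + u \<cdot> \<rho> v) \<in> EL"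
  unfolding EL_def by (rule generate.incl) (auto simp: transvections_def)

lemma linear_transvection: "linear_form \<rho> \<Longrightarrow> linear_map (\<lambda>v. v + u \<cdot> \<rho> v)"
  by (simp add: linear_form_def linear_map_def scale_add_left scale_add_right scale_mult add_ac)

lemma linear_map_comp: "linear_map g \<Longrightarrow> linear_map h \<Longrightarrow> linear_map (g \<circ> h)"
  by (simp add: linear_map_def)

section \<open>Bases adapted to given lines\<close>

lemma ordered_base2_commute: "ordered_base2 u w \<Longrightarrow> ordered_base2 w u"
  unfolding ordered_base2_def by (auto simp: insert_commute)

text \<open>The change of base is triangular with the invertible entry \<open>q\<close>, so
  coordinates are found by back substitution: first divide by \<open>q\<close> on the left, then
  correct the coefficient of \<open>u\<close>.\<close>

lemma ordered_base2_exchange: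
  assumes base: "ordered_base2 u w" and q: "q \<noteq> 0"
  shows "ordered_base2 u (u \<cdot> p + w \<cdot> q)"
proof -
  have comb: "u \<cdot> x + (u \<cdot> p + w \<cdot> q) \<cdot> y = u \<cdot> (x + p * y) + w \<cdot> (q * y)" for x y
    by (simp add: scale_add_left scale_add_right scale_mult add_ac)
  have "\<exists>x y. v = u \<cdot> x + (u \<cdot> p + w \<cdot> q) \<cdot> y" for v
  proof -
    obtain x y where "v = u \<cdot> x + w \<cdot> y" using ordered_base2_coords[OF base] by blast
    then have "v = u \<cdot> (x - p * (inverse q * y)) + (u \<cdot> p + w \<cdot> q) \<cdot> (inverse q * y)"
      using q by (simp only: comb) (simp add: mult.assoc [symmetric])
    then show ?thesis by blast
  qed
  moreover have "x = 0 \<and> y = 0" if "u \<cdot> x + (u \<cdot> p + w \<cdot> q) \<cdot> y = 0" for x y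
    using ordered_base2_independent[OF base, of "x + p * y" "q * y"] that q by (auto simp: comb)
  ultimately show ?thesis unfolding ordered_base2_iff by blast
qed

text \<open>Steinitz exchange in two rounds: \<open>u\<close> is exchanged into the given base, then
  \<open>w\<close>, whose coefficient at the other vector is nonzero because \<open>w\<close> is off
  the line of \<open>u\<close>.\<close>

lemma ordered_base2_if_not_in_line:
  assumes base: "ordered_base2 e0 e1" and u: "u \<noteq> 0" and w: "w \<notin> line u"
  shows "ordered_base2 u w"
proof -
  obtain e where e: "ordered_base2 u e"
  proof -
    obtain p q where pq: "u = e0 \<cdot> p + e1 \<cdot> q" using ordered_base2_coords[OF base] by blast
    show ?thesis
    proof (cases "q = 0")
      case False
      then show ?thesis
        using ordered_base2_exchange[OF base] pq that ordered_base2_commute by blast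
    next
      case True
      \<comment> \<open>Now \<open>u\<close> is a multiple of \<open>e0\<close>, so it replaces
        \<open>e0\<close> and \<open>e1\<close> is kept.\<close>
      then have "p \<noteq> 0" using pq u by auto
      then have "ordered_base2 e1 (e1 \<cdot> q + e0 \<cdot> p)"
        by (rule ordered_base2_exchange[OF ordered_base2_commute[OF base]])
      also have "e1 \<cdot> q + e0 \<cdot> p = u" using pq by (simp add: add.commute)
      finally show ?thesis by (rule that[OF ordered_base2_commute])
    qed
  qed
  then obtain x y where xy: "w = u \<cdot> x + e \<cdot> y" using ordered_base2_coords by blast
  with w have "y \<noteq> 0" by (auto simp: mem_line)
  then show ?thesis using ordered_base2_exchange[OF e] xy by simp
qed

text \<open>Three distinct points of a projective line form a frame: the spanning vectors of the
  first two are rescaled so that their sum spans the third.\<close>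

lemma ordered_base2_through_lines:
  assumes "has_dim UNIV 2"
    and L: "L0 \<in> Gr1" "L1 \<in> Gr1" "L2 \<in> Gr1" "L0 \<noteq> L1" "L0 \<noteq> L2" "L1 \<noteq> L2"
  obtains u w where "ordered_base2 u w" "L0 = line u" "L1 = line w" "L2 = line (u + w)"
proof -
  obtain e0 e1 where e: "ordered_base2 e0 e1"
    using assms(1) unfolding has_dim_def card_2_iff ordered_base2_def by blast
  obtain u w v where nz: "u \<noteq> 0" "w \<noteq> 0" "v \<noteq> 0"
    and lines: "L0 = line u" "L1 = line w" "L2 = line v"
    using L by (auto simp: Gr1_iff)
  have b: "ordered_base2 u w"
    using nz L lines line_eqI[of w u] by (intro ordered_base2_if_not_in_line[OF e]) auto
  then obtain x y where v: "v = u \<cdot> x + w \<cdot> y" using ordered_base2_coords by blast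
  \<comment> \<open>A vanishing coefficient would make \<open>L2\<close> equal to \<open>L1\<close>
    or \<open>L0\<close>.\<close>
  have xy: "x \<noteq> 0" "y \<noteq> 0"
    using v nz L lines by (auto simp: scale_eq_0_iff line_scale)
  show ?thesis
  proof
    show "L0 = line (u \<cdot> x)" "L1 = line (w \<cdot> y)" "L2 = line (u \<cdot> x + w \<cdot> y)"
      using xy lines v by (simp_all add: line_scale)
    have "w \<cdot> y \<notin> line (u \<cdot> x)"
      using line_eqI[of "w \<cdot> y" "u \<cdot> x"] xy nz L lines by (auto simp: line_scale scale_eq_0_iff)
    then show "ordered_base2 (u \<cdot> x) (w \<cdot> y)"
      using xy nz by (intro ordered_base2_if_not_in_line[OF e]) (auto simp: scale_eq_0_iff)
  qed
qed

end

section \<open>Affine coordinates on the projective line\<close>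

locale plane_base = right_vector_space scale
  for scale :: "'v::ab_group_add \<Rightarrow> 'd::division_ring \<Rightarrow> 'v" (infixl "\<cdot>" 75) +
  fixes e0 e1 :: 'v
  assumes base: "ordered_base2 e0 e1"
begin

text \<open>The affine chart of the projective line whose point at infinity is
  \<open>line e0\<close>.\<close>

definition pt :: "'d \<Rightarrow> 'v set" where
  "pt x = line (e0 \<cdot> x + e1)"

lemma coords_exist: "\<exists>x y. v = e0 \<cdot> x + e1 \<cdot> y"
  by (rule ordered_base2_coords[OF base])

lemma coords_eq_iff: "e0 \<cdot> x + e1 \<cdot> y = e0 \<cdot> x' + e1 \<cdot> y' \<longleftrightarrow> x = x' \<and> y = y'"
proof
  assume "e0 \<cdot> x + e1 \<cdot> y = e0 \<cdot> x' + e1 \<cdot> y'"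
  then have "e0 \<cdot> (x - x') + e1 \<cdot> (y - y') = 0"
    by (simp only: diff_conv_add_uminus scale_add_right scale_minus_right) (simp add: algebra_simps)
  then show "x = x' \<and> y = y'" using ordered_base2_independent[OF base] by fastforce
qed simp

lemma e0_nonzero: "e0 \<noteq> 0"
  using coords_eq_iff[of 1 0 0 0] by auto

lemma affine_nonzero: "e0 \<cdot> x + e1 \<noteq> 0"
  using coords_eq_iff[of x 1 0 0] by (auto simp: scale_one)

text \<open>Passage from homogeneous to affine coordinates. Scalars act on the right, so the
  denominator is divided out on the right.\<close>

lemma line_coords: "y \<noteq> 0 \<Longrightarrow> line (e0 \<cdot> x + e1 \<cdot> y) = pt (x * inverse y)"
proof -
  assume y: "y \<noteq> 0"
  then have "e0 \<cdot> x + e1 \<cdot> y = (e0 \<cdot> (x * inverse y) + e1) \<cdot> y"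
    by (simp add: scale_add_left scale_mult [symmetric] mult.assoc)
  then show ?thesis using y by (simp only: pt_def line_scale not_False_eq_True)
qed

lemma infinity_in_Gr1: "line e0 \<in> Gr1" and pt_in_Gr1: "pt x \<in> Gr1"
  using e0_nonzero affine_nonzero by (auto simp: Gr1_iff pt_def)

lemma Gr1_cases: "W \<in> Gr1 \<Longrightarrow> W = line e0 \<or> (\<exists>x. W = pt x)"
proof -
  assume "W \<in> Gr1"
  then obtain v where v: "v \<noteq> 0" "W = line v" by (auto simp: Gr1_iff)
  obtain x y where xy: "v = e0 \<cdot> x + e1 \<cdot> y" using coords_exist by blast
  show ?thesis
  proof (cases "y = 0")
    case True
    then show ?thesis using v xy by (auto simp: line_scale scale_eq_0_iff)
  next
    case False
    then show ?thesis using v xy line_coords by auto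
  qed
qed

lemma pt_eq_iff: "pt x = pt y \<longleftrightarrow> x = y"
proof
  assume "pt x = pt y"
  then have "e0 \<cdot> x + e1 \<in> line (e0 \<cdot> y + e1)"
    using self_in_line[of "e0 \<cdot> x + e1"] by (simp add: pt_def)
  then obtain z where "e0 \<cdot> x + e1 = (e0 \<cdot> y + e1) \<cdot> z" by (auto simp: mem_line)
  then have "e0 \<cdot> x + e1 \<cdot> 1 = e0 \<cdot> (y * z) + e1 \<cdot> z"
    by (simp add: scale_one scale_add_left scale_mult)
  then have "x = y * z \<and> 1 = z" by (simp only: coords_eq_iff)
  then show "x = y" by auto
qed simp

lemma pt_neq_infinity: "pt x \<noteq> line e0"
proof
  assume "pt x = line e0"
  then have "e0 \<cdot> x + e1 \<in> line e0" using self_in_line by (auto simp: pt_def)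
  then obtain z where "e0 \<cdot> x + e1 \<cdot> 1 = e0 \<cdot> z + e1 \<cdot> 0" by (auto simp: mem_line scale_one)
  then show False by (simp only: coords_eq_iff) simp
qed

text \<open>The coordinate functions are linear because coordinates are unique; they supply the
  linear forms of the transvections below.\<close>

lemma coord_forms:
  obtains r0 r1 where "linear_form r0" "linear_form r1"
    "\<And>x y. r0 (e0 \<cdot> x + e1 \<cdot> y) = x" "\<And>x y. r1 (e0 \<cdot> x + e1 \<cdot> y) = y"
proof -
  obtain r0 r1 where r: "\<And>v. v = e0 \<cdot> r0 v + e1 \<cdot> r1 v" using coords_exist by metis
  have add: "r0 (v + w) = r0 v + r0 w \<and> r1 (v + w) = r1 v + r1 w" for v w
  proof -
    have "e0 \<cdot> r0 (v + w) + e1 \<cdot> r1 (v + w)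
        = (e0 \<cdot> r0 v + e1 \<cdot> r1 v) + (e0 \<cdot> r0 w + e1 \<cdot> r1 w)"
      by (simp only: r [symmetric])
    also have "\<dots> = e0 \<cdot> (r0 v + r0 w) + e1 \<cdot> (r1 v + r1 w)"
      by (simp add: scale_add_right add_ac)
    finally show ?thesis by (simp only: coords_eq_iff)
  qed
  have scale: "r0 (v \<cdot> x) = r0 v * x \<and> r1 (v \<cdot> x) = r1 v * x" for v x
  proof -
    have "e0 \<cdot> r0 (v \<cdot> x) + e1 \<cdot> r1 (v \<cdot> x) = (e0 \<cdot> r0 v + e1 \<cdot> r1 v) \<cdot> x"
      by (simp only: r [symmetric])
    also have "\<dots> = e0 \<cdot> (r0 v * x) + e1 \<cdot> (r1 v * x)"
      by (simp add: scale_add_left scale_mult)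
    finally show ?thesis by (simp only: coords_eq_iff)
  qed
  have "r0 (e0 \<cdot> x + e1 \<cdot> y) = x \<and> r1 (e0 \<cdot> x + e1 \<cdot> y) = y" for x y
    using r[of "e0 \<cdot> x + e1 \<cdot> y"] by (simp only: coords_eq_iff)
  then show ?thesis using that[of r0 r1] add scale by (simp add: linear_form_def)
qed

section \<open>Elementary matrices and the permutations they induce\<close>

text \<open>The transvection with vector \<open>e0\<close> and form \<open>c * r1\<close>. Left
  multiplication by \<open>c\<close> keeps the form linear, since scalars act on the right.\<close>

lemma EL_upper:
  obtains g where "g \<in> EL" "linear_map g"
    "\<And>x y. g (e0 \<cdot> x + e1 \<cdot> y) = e0 \<cdot> (x + c * y) + e1 \<cdot> y"
proof -
  obtain r0 r1 where r: "linear_form r1" "\<And>x y. r1 (e0 \<cdot> x + e1 \<cdot> y) = y"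
    using coord_forms by metis
  define \<rho> where "\<rho> v = c * r1 v" for v
  have \<rho>: "linear_form \<rho>" "\<rho> e0 = 0"
    using r(1) r(2)[of 1 0] by (simp_all add: \<rho>_def linear_form_def algebra_simps scale_one)
  show ?thesis
    by (rule that[OF transvection_in_EL[OF \<rho>] linear_transvection[OF \<rho>(1)]])
      (simp add: \<rho>_def r(2) scale_add_right add_ac)
qed

lemma EL_lower:
  obtains g where "g \<in> EL" "linear_map g"
    "\<And>x y. g (e0 \<cdot> x + e1 \<cdot> y) = e0 \<cdot> x + e1 \<cdot> (c * x + y)"
proof -
  interpret swap: plane_base scale e1 e0
    by unfold_locales (rule ordered_base2_commute[OF base])
  obtain g where g: "g \<in> EL" "linear_map g"
    "\<And>x y. g (e1 \<cdot> x + e0 \<cdot> y) = e1 \<cdot> (x + c * y) + e0 \<cdot> y"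
    using swap.EL_upper by metis
  show ?thesis
    by (rule that[OF g(1,2)]) (metis g(3) add.commute)
qed

text \<open>The product upper, lower, upper of elementary matrices with entries \<open>a\<close>,
  \<open>- inverse a\<close>, \<open>a\<close> is antidiagonal.\<close>

lemma EL_weyl:
  assumes "a \<noteq> 0"
  obtains g where "g \<in> EL" "linear_map g"
    "\<And>x y. g (e0 \<cdot> x + e1 \<cdot> y) = e0 \<cdot> (a * y) + e1 \<cdot> (- inverse a * x)"
proof -
  obtain u where u: "u \<in> EL" "linear_map u"
    "\<And>x y. u (e0 \<cdot> x + e1 \<cdot> y) = e0 \<cdot> (x + a * y) + e1 \<cdot> y"
    using EL_upper by metis
  obtain l where l: "l \<in> EL" "linear_map l"
    "\<And>x y. l (e0 \<cdot> x + e1 \<cdot> y) = e0 \<cdot> x + e1 \<cdot> (- inverse a * x + y)"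
    using EL_lower by metis
  have y: "- inverse a * (x + a * y) + y = - inverse a * x" for x y
    using assms by (simp add: distrib_left mult.assoc [symmetric])
  have x: "x + a * y + a * (- inverse a * x) = a * y" for x y
    using assms by (simp add: mult.assoc [symmetric])
  show ?thesis
  proof (rule that[of "u \<circ> (l \<circ> u)"])
    show "u \<circ> (l \<circ> u) \<in> EL" "linear_map (u \<circ> (l \<circ> u))"
      using u l by (simp_all add: EL_comp linear_map_comp)
    show "(u \<circ> (l \<circ> u)) (e0 \<cdot> x + e1 \<cdot> y) = e0 \<cdot> (a * y) + e1 \<cdot> (- inverse a * x)" for x y
      by (simp only: o_apply u l x y)
  qed
qed

lemma PEL_translation:
  obtains h where "h \<in> PEL" "h (line e0) = line e0" "\<And>x. h (pt x) = pt (x + c)"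
proof -
  obtain g where g: "g \<in> EL" "linear_map g"
    "\<And>x y. g (e0 \<cdot> x + e1 \<cdot> y) = e0 \<cdot> (x + c * y) + e1 \<cdot> y"
    using EL_upper by metis
  show ?thesis
  proof (rule that[of "induced_perm g"])
    show "induced_perm g \<in> PEL" using g(1) by (simp add: PEL_def)
    show "induced_perm g (line e0) = line e0"
      using g(3)[of 1 0] by (simp add: induced_perm_line g e0_nonzero scale_one)
    show "induced_perm g (pt x) = pt (x + c)" for x
      using g(3)[of x 1] by (simp add: pt_def induced_perm_line g affine_nonzero scale_one)
  qed
qed

text \<open>Two antidiagonal matrices, with parameters \<open>a\<close> and \<open>- 1\<close>,
  multiply to the diagonal matrix with entries \<open>a\<close> and \<open>inverse a\<close>.
  Dividing by the second entry on the right yields the second factor \<open>a\<close>.\<close>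

lemma PEL_diagonal:
  assumes a: "a \<noteq> 0"
  obtains h where "h \<in> PEL" "h (line e0) = line e0" "\<And>x. h (pt x) = pt (a * x * a)"
proof -
  obtain g where g: "g \<in> EL" "linear_map g"
    "\<And>x y. g (e0 \<cdot> x + e1 \<cdot> y) = e0 \<cdot> (a * y) + e1 \<cdot> (- inverse a * x)"
    using EL_weyl[OF a] by metis
  obtain k where k: "k \<in> EL" "linear_map k"
    "\<And>x y. k (e0 \<cdot> x + e1 \<cdot> y) = e0 \<cdot> (- 1 * y) + e1 \<cdot> (- inverse (- 1) * x)"
    using EL_weyl[of "- 1"] by auto
  have gk: "(g \<circ> k) (e0 \<cdot> x + e1 \<cdot> y) = e0 \<cdot> (a * x) + e1 \<cdot> (inverse a * y)" for x y
    by (simp only: o_apply k g) simp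
  have lin: "linear_map (g \<circ> k)" using g k by (simp add: linear_map_comp)
  show ?thesis
  proof (rule that[of "induced_perm (g \<circ> k)"])
    show "induced_perm (g \<circ> k) \<in> PEL" using g k by (simp add: PEL_def EL_comp)
    have "(g \<circ> k) e0 = e0 \<cdot> a" using gk[of 1 0] by (simp add: scale_one)
    then show "induced_perm (g \<circ> k) (line e0) = line e0"
      using a by (simp add: induced_perm_line[OF lin e0_nonzero] line_scale del: o_apply)
    have "(g \<circ> k) (e0 \<cdot> x + e1) = e0 \<cdot> (a * x) + e1 \<cdot> inverse a" for x
      using gk[of x 1] by (simp add: scale_one)
    then show "induced_perm (g \<circ> k) (pt x) = pt (a * x * a)" for x
      unfolding pt_def induced_perm_line[OF lin affine_nonzero]
      using line_coords[of "inverse a" "a * x"] a by (simp add: pt_def)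
  qed
qed

section \<open>The stabiliser of the point at infinity\<close>

text \<open>A linear bijection fixing \<open>line e0\<close> is upper triangular with diagonal
  entries \<open>a\<close>, \<open>m\<close> and corner \<open>c\<close>; in the chart it acts by
  \<open>x \<mapsto> (a * x + c) * inverse m\<close>.\<close>

lemma PGL_stabiliser_affine:
  assumes "h \<in> PGL" and fix_inf: "h (line e0) = line e0"
  obtains f where "affine f" "\<And>x. h (pt x) = pt (f x)"
proof -
  from assms(1) obtain g where g: "linear_map g" "bij g" "h = induced_perm g"
    by (auto simp: PGL_def GL_def)
  have "line (g e0) = line e0"
    using fix_inf g by (simp add: induced_perm_line e0_nonzero)
  then obtain a where a: "g e0 = e0 \<cdot> a" using self_in_line mem_line by metis
  then have a0: "a \<noteq> 0"
    using linear_map_nonzero[OF g(1,2) e0_nonzero] by auto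
  obtain c m where cm: "g e1 = e0 \<cdot> c + e1 \<cdot> m" using coords_exist by blast
  have lin: "g (v + w) = g v + g w" "g (v \<cdot> x) = g v \<cdot> x" for v w x
    using g(1) by (auto simp: linear_map_def)
  \<comment> \<open>Otherwise \<open>g e1\<close> would lie on \<open>line e0\<close>, where a
    multiple of \<open>e0\<close> already has the same image.\<close>
  have m0: "m \<noteq> 0"
  proof
    assume "m = 0"
    then have "g e1 = g (e0 \<cdot> (inverse a * c))"
      using a0 by (simp add: cm lin a scale_mult scale_inverse_cancel)
    then have "e1 = e0 \<cdot> (inverse a * c)" using g(2) by (metis bij_is_inj injD)
    then have "e0 \<cdot> 0 + e1 \<cdot> 1 = e0 \<cdot> (inverse a * c) + e1 \<cdot> 0" by (simp add: scale_one)
    then show False by (simp only: coords_eq_iff) simp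
  qed
  show ?thesis
  proof (rule that)
    show "affine (\<lambda>x. a * x * inverse m + c * inverse m)"
      using a0 m0 unfolding affine_def by (metis inverse_zero_imp_zero)
    fix x
    have "g (e0 \<cdot> x + e1) = e0 \<cdot> (a * x + c) + e1 \<cdot> m"
      by (simp add: lin a cm scale_add_right scale_mult add_ac)
    then show "h (pt x) = pt (a * x * inverse m + c * inverse m)"
      using m0 g by (simp add: pt_def [of x] induced_perm_line affine_nonzero line_coords distrib_right)
  qed
qed

end


section \<open>Isomorphisms of the permutation groups\<close>

text \<open>Since \<open>inverse x - 1 = inverse x * (1 - x)\<close>, its inverse is
  \<open>inverse (1 - x) * x\<close>. The identity alternates inversions with shifts by 1, so it can
  be followed through two additive maps linked by inversion.\<close>

lemma inverse_one_minus:
  fixes x :: "'d::division_ring"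
  assumes "x \<noteq> 0" "x \<noteq> 1"
  shows "inverse (inverse x - 1) + 1 = inverse (1 - x)"
proof -
  have nz: "1 - x \<noteq> 0" using assms by simp
  have "inverse x - 1 = inverse x * (1 - x)" using assms by (simp add: right_diff_distrib)
  then have "inverse (inverse x - 1) = inverse (1 - x) * x"
    using assms nz by (simp add: nonzero_inverse_mult_distrib)
  then have "inverse (inverse x - 1) + 1 = inverse (1 - x) * x + inverse (1 - x) * (1 - x)"
    using nz by simp
  also have "\<dots> = inverse (1 - x)" by (simp add: right_diff_distrib)
  finally show ?thesis .
qed

text \<open>Equivariance carries the stabiliser of infinity on one side to that on the other, and
  both act by affine maps. The bases are arbitrary, so that the statement can also be applied with
  the two base vectors exchanged.\<close>

lemma coordinate_map_additive:
  fixes s :: "'v::ab_group_add \<Rightarrow> 'd::division_ring \<Rightarrow> 'v"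
    and s' :: "'w::ab_group_add \<Rightarrow> 'e::division_ring \<Rightarrow> 'w"
  assumes "plane_base s e0 e1" and "plane_base s' f0 f1"
    and H: "right_vector_space.PEL s \<subseteq> H" "H \<subseteq> right_vector_space.PGL s"
    and H': "right_vector_space.PEL s' \<subseteq> H'" "H' \<subseteq> right_vector_space.PGL s'"
    and \<phi>: "\<phi> ` H = H'"
    and \<psi>: "bij_betw \<psi> (right_vector_space.Gr1 s) (right_vector_space.Gr1 s')"
    and equivariant: "\<forall>h\<in>H. \<forall>W\<in>right_vector_space.Gr1 s. \<psi> (h W) = \<phi> h (\<psi> W)"
    and infinity: "\<psi> (right_vector_space.line s e0) = right_vector_space.line s' f0"
    and origin: "\<psi> (right_vector_space.line s e1) = right_vector_space.line s' f1"
  obtains \<theta> where "bij \<theta>" "\<And>x y. \<theta> (x + y) = \<theta> x + \<theta> y"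
    "\<And>x. \<psi> (right_vector_space.line s (s e0 x + e1)) = right_vector_space.line s' (s' f0 (\<theta> x) + f1)"
proof -
  interpret A: plane_base s e0 e1 by fact
  interpret B: plane_base s' f0 f1 by fact
  have inj: "W = W'" if "\<psi> W = \<psi> W'" "W \<in> A.Gr1" "W' \<in> A.Gr1" for W W'
    using that \<psi> by (auto simp: bij_betw_def inj_on_def)
  have "\<exists>y. \<psi> (A.pt x) = B.pt y" for x
  proof -
    have "\<psi> (A.pt x) \<in> B.Gr1" using bij_betwE[OF \<psi>] A.pt_in_Gr1 by blast
    moreover have "\<psi> (A.pt x) \<noteq> B.line f0"
      using inj[OF _ A.pt_in_Gr1 A.infinity_in_Gr1] A.pt_neq_infinity infinity by metis
    ultimately show ?thesis using B.Gr1_cases by blast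
  qed
  then obtain \<theta> where \<theta>: "\<And>x. \<psi> (A.pt x) = B.pt (\<theta> x)" by metis
  have "\<exists>x. \<theta> x = y" for y
  proof -
    obtain W where W: "W \<in> A.Gr1" "\<psi> W = B.pt y"
      using \<psi> B.pt_in_Gr1[of y] by (metis bij_betw_imp_surj_on imageE)
    then obtain x where "W = A.pt x"
      using A.Gr1_cases[of W] infinity B.pt_neq_infinity[of y] by auto
    then show ?thesis using W \<theta> B.pt_eq_iff by auto
  qed
  then obtain \<eta> where \<theta>\<eta>: "\<And>y. \<theta> (\<eta> y) = y" by metis
  have \<theta>_inj: "x = y" if "\<theta> x = \<theta> y" for x y
    using that inj[of "A.pt x" "A.pt y"] \<theta> A.pt_in_Gr1 A.pt_eq_iff by auto
  then have \<eta>\<theta>: "\<eta> (\<theta> x) = x" for x using \<theta>\<eta> by blast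
  have bij: "bij \<theta>" by (rule bijI') (use \<theta>_inj \<theta>\<eta> in metis)+
  have "\<psi> (A.pt 0) = B.pt 0" using origin by (simp add: A.pt_def B.pt_def)
  then have zero: "\<theta> 0 = 0" using \<theta> B.pt_eq_iff by auto
  \<comment> \<open>An element of \<open>H'\<close> fixing infinity comes from an element of
    \<open>H\<close>, which fixes infinity because \<open>\<psi>\<close> is injective, and so acts
    by an affine map on the source.\<close>
  have pull: "affine (\<lambda>x. \<eta> (k (\<theta> x)))"
    if h': "h' \<in> H'" "h' (B.line f0) = B.line f0" "\<And>y. h' (B.pt y) = B.pt (k y)" for h' k
  proof -
    obtain h where h: "h \<in> H" "h' = \<phi> h" using \<phi> h'(1) by auto
    then have hPGL: "h \<in> A.PGL" using H by auto
    have "\<psi> (h (A.line e0)) = \<psi> (A.line e0)"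
      using equivariant[rule_format, OF h(1) A.infinity_in_Gr1] h h' infinity by simp
    then have "h (A.line e0) = A.line e0"
      using inj A.PGL_closed[OF hPGL] A.infinity_in_Gr1 by blast
    then obtain f where f: "affine f" "\<And>x. h (A.pt x) = A.pt (f x)"
      using A.PGL_stabiliser_affine[OF hPGL] by blast
    have "k (\<theta> x) = \<theta> (f x)" for x
      using equivariant[rule_format, OF h(1) A.pt_in_Gr1[of x]] h h' by (simp add: f \<theta> B.pt_eq_iff)
    then show ?thesis using f(1) by (simp only: \<eta>\<theta>)
  qed
  have push: "affine (\<lambda>y. \<theta> (\<eta> y + c))" for c
  proof -
    obtain h where h: "h \<in> A.PEL" "h (A.line e0) = A.line e0" "\<And>x. h (A.pt x) = A.pt (x + c)"
      using A.PEL_translation[of c] by blast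
    have hH: "h \<in> H" using h H by auto
    then have hPGL: "\<phi> h \<in> B.PGL" using \<phi> H' by auto
    have "\<phi> h (B.line f0) = B.line f0"
      using equivariant[rule_format, OF hH A.infinity_in_Gr1] h infinity by simp
    then obtain f where f: "affine f" "\<And>x. \<phi> h (B.pt x) = B.pt (f x)"
      using B.PGL_stabiliser_affine[OF hPGL] by blast
    have "\<theta> (\<eta> y + c) = f y" for y
      using equivariant[rule_format, OF hH A.pt_in_Gr1[of "\<eta> y"]] by (simp add: f h \<theta> \<theta>\<eta> B.pt_eq_iff)
    then show ?thesis using f(1) by (simp only:)
  qed
  \<comment> \<open>The translations and the maps \<open>x \<mapsto> a * x * a\<close> are induced
    by \<open>PEL\<close>, hence available in \<open>H'\<close> and open to
    \<open>pull\<close>.\<close>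
  have "\<theta> (x + y) = \<theta> x + \<theta> y" for x y
  proof (rule additive_if_conjugates_affine[where \<eta> = \<eta>])
    show "affine (\<lambda>x. \<eta> (\<theta> x + c))" for c
    proof -
      obtain h' where "h' \<in> B.PEL" "h' (B.line f0) = B.line f0" "\<And>x. h' (B.pt x) = B.pt (x + c)"
        using B.PEL_translation[of c] by blast
      then show ?thesis using pull[of h' "\<lambda>y. y + c"] H' by auto
    qed
    show "affine (\<lambda>x. \<eta> (a * \<theta> x * a))" if a: "a \<noteq> 0" for a
    proof -
      obtain h' where "h' \<in> B.PEL" "h' (B.line f0) = B.line f0" "\<And>x. h' (B.pt x) = B.pt (a * x * a)"
        using B.PEL_diagonal[OF a] by blast
      then show ?thesis using pull[of h' "\<lambda>y. a * y * a"] H' by auto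
    qed
  qed (use \<eta>\<theta> \<theta>\<eta> zero push in auto)
  then show ?thesis by (rule that[OF bij]) (rule \<theta>[unfolded A.pt_def B.pt_def])
qed

section \<open>Normalised coordinates and the application of Hua's theorem\<close>

theorem mainTheorem2:
  fixes s :: "'v::ab_group_add \<Rightarrow> 'd::division_ring \<Rightarrow> 'v"
    and s' :: "'w::ab_group_add \<Rightarrow> 'e::division_ring \<Rightarrow> 'w"
    and H :: "('v set \<Rightarrow> 'v set) set"
    and H' :: "('w set \<Rightarrow> 'w set) set"
    and \<phi> :: "('v set \<Rightarrow> 'v set) \<Rightarrow> ('w set \<Rightarrow> 'w set)"
    and \<psi> :: "'v set \<Rightarrow> 'w set"
  assumes "right_vector_space s" and "right_vector_space.has_dim s UNIV 2"
    and "right_vector_space s'" and "right_vector_space.has_dim s' UNIV 2"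
    and "subgroup H (BijGroup (right_vector_space.Gr1 s))"
    and "right_vector_space.PEL s \<subseteq> H" and "H \<subseteq> right_vector_space.PGL s"
    and "subgroup H' (BijGroup (right_vector_space.Gr1 s'))"
    and "right_vector_space.PEL s' \<subseteq> H'" and "H' \<subseteq> right_vector_space.PGL s'"
    and "perm_group_iso H (right_vector_space.Gr1 s) H' (right_vector_space.Gr1 s') \<phi> \<psi>"
  shows "\<exists>\<theta> :: 'd \<Rightarrow> 'e.
    (skew_field_iso \<theta> \<or> skew_field_anti_iso \<theta>) \<and> induces s s' \<theta> \<psi>"
proof -
  interpret V: right_vector_space s by fact
  interpret W: right_vector_space s' by fact
  have \<phi>: "\<phi> ` H = H'" and \<psi>: "bij_betw \<psi> V.Gr1 W.Gr1"
    and equivariant: "\<forall>h\<in>H. \<forall>x\<in>V.Gr1. \<psi> (h x) = \<phi> h (\<psi> x)"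
    using assms(11) by (auto simp: perm_group_iso_def iso_def bij_betw_def)
  obtain e0 e1 where e: "V.ordered_base2 e0 e1"
    using assms(2) unfolding V.has_dim_def card_2_iff V.ordered_base2_def by blast
  interpret E: plane_base s e0 e1 by unfold_locales (rule e)
  \<comment> \<open>In the exchanged base the origin becomes the point at infinity and nonzero
    coordinates are inverted.\<close>
  interpret E': plane_base s e1 e0 by unfold_locales (rule V.ordered_base2_commute[OF e])
  have line_e1: "V.line e1 = E.pt 0" by (simp add: E.pt_def)
  have inj: "\<psi> x \<noteq> \<psi> y" if "x \<noteq> y" "x \<in> V.Gr1" "y \<in> V.Gr1" for x y
    using that \<psi> by (auto simp: bij_betw_def inj_on_def)
  have into: "\<psi> x \<in> W.Gr1" if "x \<in> V.Gr1" for x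
    using that \<psi> by (rule bij_betwE[THEN bspec, rotated])
  \<comment> \<open>The target base is fitted to the images of infinity, 0 and 1; the third
    condition yields \<open>\<theta> 1 = 1\<close>.\<close>
  obtain f0 f1 where f: "W.ordered_base2 f0 f1" "\<psi> (V.line e0) = W.line f0"
    "\<psi> (V.line e1) = W.line f1" "\<psi> (E.pt 1) = W.line (f0 + f1)"
  proof (rule W.ordered_base2_through_lines[OF assms(4)])
    show "\<psi> (V.line e0) \<in> W.Gr1" "\<psi> (V.line e1) \<in> W.Gr1" "\<psi> (E.pt 1) \<in> W.Gr1"
      by (intro into E.infinity_in_Gr1 E'.infinity_in_Gr1 E.pt_in_Gr1)+
    show "\<psi> (V.line e0) \<noteq> \<psi> (V.line e1)" "\<psi> (V.line e0) \<noteq> \<psi> (E.pt 1)" "\<psi> (V.line e1) \<noteq> \<psi> (E.pt 1)"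
      unfolding line_e1
      by (intro inj E.infinity_in_Gr1 E.pt_in_Gr1 E.pt_neq_infinity [symmetric];
        simp add: E.pt_eq_iff)+
  qed (rule that)
  interpret F: plane_base s' f0 f1 by unfold_locales (rule f(1))
  interpret F': plane_base s' f1 f0 by unfold_locales (rule W.ordered_base2_commute[OF f(1)])
  obtain \<theta> where bij: "bij \<theta>" and add: "\<And>x y. \<theta> (x + y) = \<theta> x + \<theta> y"
    and \<theta>: "\<And>x. \<psi> (V.line (s e0 x + e1)) = W.line (s' f0 (\<theta> x) + f1)"
    by (rule coordinate_map_additive[OF E.plane_base_axioms F.plane_base_axioms
          assms(6,7,9,10) \<phi> \<psi> equivariant f(2,3)], rule that)
  obtain \<eta> where \<eta>_bij: "bij \<eta>" and \<eta>_add: "\<And>x y. \<eta> (x + y) = \<eta> x + \<eta> y"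
    and \<eta>: "\<And>x. \<psi> (V.line (s e1 x + e0)) = W.line (s' f1 (\<eta> x) + f0)"
    by (rule coordinate_map_additive[OF E'.plane_base_axioms F'.plane_base_axioms
          assms(6,7,9,10) \<phi> \<psi> equivariant f(3,2)], rule that)
  have zero: "\<theta> 0 = 0" "\<eta> 0 = 0" using add[of 0 0] \<eta>_add[of 0 0] by simp_all
  have diff: "\<theta> (x - y) = \<theta> x - \<theta> y" "\<eta> (x' - y') = \<eta> x' - \<eta> y'" for x y x' y'
    using add[of "x - y" y] \<eta>_add[of "x' - y'" y'] by (simp_all add: eq_diff_eq)
  have \<eta>0: "\<eta> x \<noteq> 0" if "x \<noteq> 0" for x
    using that zero \<eta>_bij by (metis bij_is_inj injD)
  have \<theta>0: "\<theta> x \<noteq> 0" if "x \<noteq> 0" for x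
    using that zero bij by (metis bij_is_inj injD)
  have "F.pt (\<theta> 1) = F.pt 1"
    using f(4) \<theta>[of 1] by (simp add: E.pt_def F.pt_def W.scale_one)
  then have one: "\<theta> 1 = 1" by (simp add: F.pt_eq_iff)
  have \<theta>_\<eta>: "\<theta> (inverse x) = inverse (\<eta> x)" if "x \<noteq> 0" for x
  proof -
    have "V.line (s e1 x + e0) = E.pt (inverse x)"
      using E.line_coords[OF that, of 1] by (simp add: add.commute V.scale_one)
    moreover have "W.line (s' f1 (\<eta> x) + f0) = F.pt (inverse (\<eta> x))"
      using F.line_coords[OF \<eta>0[OF that], of 1] by (simp add: add.commute W.scale_one)
    ultimately have "F.pt (\<theta> (inverse x)) = F.pt (inverse (\<eta> x))"
      using \<theta>[of "inverse x"] \<eta>[of x] by (simp add: E.pt_def F.pt_def)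
    then show ?thesis by (simp add: F.pt_eq_iff)
  qed
  have \<eta>_one: "\<eta> 1 = 1" using \<theta>_\<eta>[of 1] one by (metis inverse_1 inverse_inverse_eq one_neq_zero)
  have inv: "\<theta> (inverse x) = inverse (\<theta> x)" for x
  proof (cases "x = 0 \<or> x = 1")
    case True
    then show ?thesis using zero one by auto
  next
    case False
    \<comment> \<open>With \<open>y = 1 - x\<close> the element to invert is \<open>1 - y\<close>,
      the right-hand side of \<open>inverse_one_minus\<close>. The left-hand side is evaluated by
      \<open>\<eta>\<close> inside the outer inverse and by \<open>\<theta>\<close> outside.\<close>
    define y where "y = 1 - x"
    have y: "y \<noteq> 0" "y \<noteq> 1" using False by (auto simp: y_def)
    then have \<theta>y: "\<theta> y \<noteq> 0" "\<theta> y \<noteq> 1"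
      using \<theta>0[of y] \<theta>0[of "y - 1"] by (auto simp: diff one)
    have "\<eta> (inverse y - 1) = inverse (\<theta> y) - 1"
      using \<theta>_\<eta>[of "inverse y"] y by (simp add: diff \<eta>_one)
    moreover have "inverse y - 1 \<noteq> 0" using y by (metis inverse_1 inverse_inverse_eq right_minus_eq)
    ultimately have "\<theta> (inverse (inverse y - 1) + 1) = inverse (inverse (\<theta> y) - 1) + 1"
      by (simp add: \<theta>_\<eta> add one)
    then have "\<theta> (inverse (1 - y)) = inverse (1 - \<theta> y)"
      by (simp only: inverse_one_minus[OF y] inverse_one_minus[OF \<theta>y])
    then show ?thesis by (simp add: y_def diff one)
  qed
  have "skew_field_iso \<theta> \<or> skew_field_anti_iso \<theta>"
    by (rule hua_theorem[OF bij one add inv])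
  moreover have "induces s s' \<theta> \<psi>"
    unfolding induces_def using e f \<theta> by blast
  ultimately show ?thesis by blast
qed

end
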